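(* Let $\beta, \gamma < \epsilon_0$ be ordinals and let $B, C \subseteq \mathbb{N}$ be finite sets such that $B$ is at most $\beta$-large and $C$ is at most $\gamma$-large. Then $B \cup C$ is at most $(\beta \oplus \gamma)$-large.
   Context: Every ordinal $\alpha<\epsilon_0$ has a unique Cantor normal form $\alpha=\omega^{\alpha_s}a_s+\dots+\omega^{\alpha_0}a_0$ with $\alpha_0<\dots<\alpha_s<\alpha$ and $a_i\geq 1$. $\beta\oplus\gamma$ is the natural (Hessenberg) sum, obtained by adding coefficients of like powers of $\omega$ in the Cantor normal forms. Fundamental sequences: $\{0\}(x)=0$; for $\alpha\neq 0$ write $\alpha=\beta+\omega^\gamma$ where $\beta=0$ or the smallest exponent of $\beta$ is $\geq\gamma$; then $\{\alpha\}(x)=\beta$ if $\gamma=0$, $\{\alpha\}(x)=\beta+\omega^{\gamma'}\cdot x$ if $\gamma=\gamma'+1$, and $\{\alpha\}(x)=\beta+\omega^{\{\gamma\}(x)}$ if $\gamma$ is a limit. For a finite set $X=\{x_0<\dots<x_s\}$, $\{\alpha\}(X)=\{\cdots\{\{\alpha\}(x_0)\}(x_1)\cdots\}(x_s)$ (and $\{\alpha\}(\emptyset)=\alpha$). $X$ is $\alpha$-large if $\{\alpha\}(X)=0$, and $\alpha$-small otherwise. A nonempty finite set $X$ is at most $\alpha$-large if $X\setminus\{\max X\}$ is $\alpha$-small; by convention $\emptyset$ is at most $0$-large.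
   Formalization: The finite sets B and C are taken to consist of positive integers; if 0 is allowed the claim fails, e.g. for β = ω², B = {1,2,3,4}, γ = ω^ω, C = {0,5}. *)

theory Defs
  imports Main
begin

text \<open>
  Ordinals below \<open>\<epsilon>\<^sub>0\<close> are represented by their Cantor normal forms: \<open>Term a n c\<close> stands
  for \<open>\<omega>\<^bsup>a\<^esup>\<cdot>n + c\<close>, the leading power coming first. The terms that are normal forms are
  singled out by \<open>nf\<close>.
\<close>

datatype cnf = Zero | Term cnf nat cnf

fun cless :: "cnf \<Rightarrow> cnf \<Rightarrow> bool"  (infix "\<prec>" 50) where
  "_ \<prec> Zero \<longleftrightarrow> False"
| "Zero \<prec> Term _ _ _ \<longleftrightarrow> True"
| "Term a n c \<prec> Term a' n' c' \<longleftrightarrow> a \<prec> a' \<or> a = a' \<and> (n < n' \<or> n = n' \<and> c \<prec> c')"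

fun nf :: "cnf \<Rightarrow> bool" where
  "nf Zero \<longleftrightarrow> True"
| "nf (Term a n c) \<longleftrightarrow> nf a \<and> 1 \<le> n \<and> nf c \<and> (case c of Zero \<Rightarrow> True | Term b _ _ \<Rightarrow> b \<prec> a)"

fun hsum :: "cnf \<Rightarrow> cnf \<Rightarrow> cnf"  (infixl "\<oplus>" 65) where
  "Zero \<oplus> c = c"
| "b \<oplus> Zero = b"
| "Term a n b \<oplus> Term a' n' b' =
    (if a = a' then Term a (n + n') (b \<oplus> b')
     else if a' \<prec> a then Term a n (b \<oplus> Term a' n' b')
     else Term a' n' (Term a n b \<oplus> b'))"

text \<open>Ordinary ordinal addition, and \<open>\<omega>\<^bsup>a\<^esup>\<cdot>n\<close>.\<close>

fun oadd :: "cnf \<Rightarrow> cnf \<Rightarrow> cnf"  (infixl "+\<^sub>o" 65) where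
  "Zero +\<^sub>o c = c"
| "b +\<^sub>o Zero = b"
| "Term a n b +\<^sub>o Term a' n' b' =
    (if a \<prec> a' then Term a' n' b'
     else if a = a' then Term a (n + n') b'
     else Term a n (b +\<^sub>o Term a' n' b'))"

definition omega_mult :: "cnf \<Rightarrow> nat \<Rightarrow> cnf" where
  "omega_mult a n = (if n = 0 then Zero else Term a n Zero)"

abbreviation omega_power :: "cnf \<Rightarrow> cnf" where
  "omega_power a \<equiv> omega_mult a 1"

text \<open>
  The unique decomposition \<open>\<alpha> = \<beta> + \<omega>\<^bsup>\<gamma>\<^esup>\<close> of \<open>\<alpha> \<noteq> 0\<close> in which \<open>\<beta> = 0\<close> or the smallest exponent
  of \<open>\<beta>\<close> is at least \<open>\<gamma>\<close>: \<open>\<gamma> = last_exp \<alpha>\<close> and \<open>\<beta> = init \<alpha>\<close> (see \<open>decomp\<close> and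
  \<open>decomp_unique\<close> below). The values at \<open>Zero\<close> are irrelevant.
\<close>

fun last_exp :: "cnf \<Rightarrow> cnf" where
  "last_exp Zero = Zero"
| "last_exp (Term a n c) = (if c = Zero then a else last_exp c)"

fun init :: "cnf \<Rightarrow> cnf" where
  "init Zero = Zero"
| "init (Term a n c) = (if c = Zero then omega_mult a (n - 1) else Term a n (init c))"

lemma size_last_exp: "\<alpha> \<noteq> Zero \<Longrightarrow> size (last_exp \<alpha>) < size \<alpha>"
  by (induction \<alpha>) auto

text \<open>
  Fundamental sequences. A nonzero \<open>\<gamma>\<close> is a successor iff \<open>last_exp \<gamma> = Zero\<close>, and then
  \<open>\<gamma> = init \<gamma> + 1\<close> (see \<open>successor_iff\<close>).
\<close>

function fs :: "cnf \<Rightarrow> nat \<Rightarrow> cnf" where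
  "fs \<alpha> x =
    (if \<alpha> = Zero then Zero
     else let \<beta> = init \<alpha>; \<gamma> = last_exp \<alpha> in
       if \<gamma> = Zero then \<beta>
       else if last_exp \<gamma> = Zero then \<beta> +\<^sub>o omega_mult (init \<gamma>) x
       else \<beta> +\<^sub>o omega_power (fs \<gamma> x))"
  by pat_completeness auto
termination by (relation "measure (\<lambda>(\<alpha>, x). size \<alpha>)") (auto simp: size_last_exp)

declare fs.simps [simp del]

definition fs_set :: "cnf \<Rightarrow> nat set \<Rightarrow> cnf" where
  "fs_set \<alpha> X = foldl fs \<alpha> (sorted_list_of_set X)"

definition large :: "cnf \<Rightarrow> nat set \<Rightarrow> bool" where
  "large \<alpha> X \<longleftrightarrow> finite X \<and> fs_set \<alpha> X = Zero"

definition small :: "cnf \<Rightarrow> nat set \<Rightarrow> bool" where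
  "small \<alpha> X \<longleftrightarrow> finite X \<and> \<not> large \<alpha> X"

definition at_most_large :: "cnf \<Rightarrow> nat set \<Rightarrow> bool" where
  "at_most_large \<alpha> X \<longleftrightarrow>
    finite X \<and> (if X = {} then \<alpha> = Zero else small \<alpha> (X - {Max X}))"

text \<open>
  Adequacy: normal forms are well-ordered by \<open>\<prec>\<close>, the operations preserve them, and the
  decomposition and the successor test used in \<open>fs\<close> are the intended ones.
\<close>

lemma cless_irrefl [simp]: "\<not> a \<prec> a"
  by (induction a) auto

lemma cless_trans: "a \<prec> b \<Longrightarrow> b \<prec> c \<Longrightarrow> a \<prec> c"
proof (induction a arbitrary: b c)
  case Zero
  then show ?case by (cases b; cases c) auto
next
  case (Term a1 n a2)
  then show ?case by (cases b; cases c) (auto intro: less_trans)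
qed

lemma cless_total: "a \<prec> b \<or> a = b \<or> b \<prec> a"
proof (induction a arbitrary: b)
  case Zero
  then show ?case by (cases b) auto
next
  case (Term a1 n a2)
  note ih1 = Term.IH(1) and ih2 = Term.IH(2)
  show ?case
  proof (cases b)
    case (Term b1 k b2)
    then show ?thesis using ih1[of b1] ih2[of b2] by (cases n k rule: linorder_cases) auto
  qed simp
qed

lemma cless_Zero_iff: "Zero \<prec> a \<longleftrightarrow> a \<noteq> Zero"
  by (cases a) auto

abbreviation cless_nf :: "cnf \<Rightarrow> cnf \<Rightarrow> bool" where
  "cless_nf x y \<equiv> nf x \<and> nf y \<and> x \<prec> y"

lemma accp_Term:
  assumes "Wellfounded.accp cless_nf a"
  shows "nf (Term a n c) \<Longrightarrow> Wellfounded.accp cless_nf c \<Longrightarrow>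
    Wellfounded.accp cless_nf (Term a n c)"
  using assms
proof (induction a arbitrary: n c rule: accp.induct)
  case (accI a)
  have below: "Wellfounded.accp cless_nf y"
    if "nf y" "case y of Zero \<Rightarrow> True | Term b _ _ \<Rightarrow> b \<prec> a" "nf a" for y
    using that
  proof (induction y)
    case Zero
    show ?case by (rule accp.accI) auto
  next
    case (Term b k d)
    have "b \<prec> a" "nf d" using Term.prems by auto
    moreover have "case d of Zero \<Rightarrow> True | Term e _ _ \<Rightarrow> e \<prec> a"
      using Term.prems cless_trans[of _ b a] by (cases d) auto
    ultimately have "Wellfounded.accp cless_nf d"
      using Term.IH(2) Term.prems(3) by blast
    then show ?case using accI.IH[of b k d] Term.prems by simp
  qed
  show ?case using \<open>Wellfounded.accp cless_nf c\<close> \<open>nf (Term a n c)\<close>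
  proof (induction n arbitrary: c rule: less_induct)
    case (less n)
    note outer = less.IH
    from less.prems show ?case
    proof (induction c rule: accp.induct)
      case (accI c)
      show ?case
      proof (rule accp.accI)
        fix y assume y: "cless_nf y (Term a n c)"
        show "Wellfounded.accp cless_nf y"
        proof (cases y)
          case Zero
          then show ?thesis using below[of y] y by auto
        next
          case (Term b k d)
          consider "b \<prec> a" | "b = a" "k < n" | "b = a" "k = n" "d \<prec> c"
            using y Term by auto
          then show ?thesis
          proof cases
            case 1
            then show ?thesis using below[of y] y Term by auto
          next
            case 2
            have "Wellfounded.accp cless_nf d" using below[of d] y Term 2 by auto
            then show ?thesis using outer[of k d] y Term 2 by auto
          next
            case 3
            then show ?thesis using accI.IH[of d] accI.prems y Term by auto
          qed
        qed
      qed
    qed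
  qed
qed

lemma wfp_cless_nf: "wfp cless_nf"
proof (rule accp_wfpI, rule allI)
  fix x
  show "Wellfounded.accp cless_nf x"
  proof (cases "nf x")
    case False
    show ?thesis by (rule accp.accI) (use False in simp)
  next
    case True
    then show ?thesis
    proof (induction x)
      case Zero
      show ?case by (rule accp.accI) auto
    next
      case (Term a n c)
      then show ?case using accp_Term[of a n c] by simp
    qed
  qed
qed

abbreviation lead_less :: "cnf \<Rightarrow> cnf \<Rightarrow> bool" where
  "lead_less c a \<equiv> (case c of Zero \<Rightarrow> True | Term b _ _ \<Rightarrow> b \<prec> a)"

lemma lead_less_hsum: "lead_less b a \<Longrightarrow> lead_less c a \<Longrightarrow> lead_less (b \<oplus> c) a"
  by (induction b c rule: hsum.induct) auto

lemma nf_hsum: "nf b \<Longrightarrow> nf c \<Longrightarrow> nf (b \<oplus> c)"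
proof (induction b c rule: hsum.induct)
  case (3 a n b a' n' b')
  then show ?case using cless_total[of a a']
    by (auto intro!: lead_less_hsum)
qed auto

lemma lead_less_oadd: "lead_less b a \<Longrightarrow> lead_less c a \<Longrightarrow> lead_less (b +\<^sub>o c) a"
  by (induction b c rule: oadd.induct) auto

lemma nf_oadd: "nf b \<Longrightarrow> nf c \<Longrightarrow> nf (b +\<^sub>o c)"
proof (induction b c rule: oadd.induct)
  case (3 a n b a' n' b')
  then show ?case using cless_total[of a a']
    by (auto intro!: lead_less_oadd)
qed auto

lemma nf_omega_mult: "nf a \<Longrightarrow> nf (omega_mult a n)"
  by (auto simp: omega_mult_def)

lemma nf_last_exp: "nf \<alpha> \<Longrightarrow> nf (last_exp \<alpha>)"
  by (induction \<alpha>) auto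

lemma lead_less_init: "lead_less b a \<Longrightarrow> lead_less (init b) a"
  by (cases b) (auto simp: omega_mult_def)

lemma nf_init: "nf \<alpha> \<Longrightarrow> nf (init \<alpha>)"
  by (induction \<alpha>) (auto simp: nf_omega_mult intro!: lead_less_init)

lemma nf_fs: "nf \<alpha> \<Longrightarrow> nf (fs \<alpha> x)"
proof (induction \<alpha> x rule: fs.induct)
  case (1 \<alpha> x)
  then show ?case
    by (subst fs.simps) (auto simp: Let_def intro!: nf_oadd nf_omega_mult nf_init nf_last_exp)
qed

lemma last_exp_le_lead:
  "nf (Term a n c) \<Longrightarrow> c \<noteq> Zero \<Longrightarrow> last_exp c \<prec> a"
proof (induction c arbitrary: a n)
  case (Term b k d)
  show ?case
  proof (cases "d = Zero")
    case False
    then have "last_exp d \<prec> b" "b \<prec> a" using Term.IH(2)[of b k] Term.prems by auto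
    then show ?thesis using False cless_trans by auto
  qed (use Term.prems in simp)
qed auto

lemma decomp:
  assumes "nf \<alpha>" "\<alpha> \<noteq> Zero"
  shows "\<alpha> = init \<alpha> +\<^sub>o omega_power (last_exp \<alpha>)"
    and "init \<alpha> = Zero \<or> \<not> last_exp (init \<alpha>) \<prec> last_exp \<alpha>"
proof -
  show "\<alpha> = init \<alpha> +\<^sub>o omega_power (last_exp \<alpha>)"
    using assms
  proof (induction \<alpha>)
    case (Term a n c)
    show ?case
    proof (cases "c = Zero")
      case True
      then show ?thesis using Term by (auto simp: omega_mult_def)
    next
      case False
      have l: "last_exp c \<prec> a" using last_exp_le_lead Term False by blast
      then have "\<not> a \<prec> last_exp c" "a \<noteq> last_exp c" using cless_trans cless_irrefl by blast+
      then show ?thesis using Term False by (auto simp: omega_mult_def)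
    qed
  qed auto
  show "init \<alpha> = Zero \<or> \<not> last_exp (init \<alpha>) \<prec> last_exp \<alpha>"
    using assms
  proof (induction \<alpha>)
    case (Term a n c)
    show ?case
    proof (cases "c = Zero")
      case False
      have l: "last_exp c \<prec> a" using last_exp_le_lead Term False by blast
      then have "\<not> a \<prec> last_exp c" using cless_trans cless_irrefl by blast
      then show ?thesis using Term False by auto
    qed (auto simp: omega_mult_def)
  qed auto
qed

lemma decomp_unique:
  assumes "nf \<beta>" "nf \<gamma>" "\<beta> = Zero \<or> \<not> last_exp \<beta> \<prec> \<gamma>"
  shows "init (\<beta> +\<^sub>o omega_power \<gamma>) = \<beta>" and "last_exp (\<beta> +\<^sub>o omega_power \<gamma>) = \<gamma>"
proof -
  have "init (\<beta> +\<^sub>o omega_power \<gamma>) = \<beta> \<and> last_exp (\<beta> +\<^sub>o omega_power \<gamma>) = \<gamma>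
    \<and> \<beta> +\<^sub>o omega_power \<gamma> \<noteq> Zero"
    using assms
  proof (induction \<beta>)
    case Zero
    then show ?case by (auto simp: omega_mult_def)
  next
    case (Term a n c)
    show ?case
    proof (cases "c = Zero")
      case True
      then show ?thesis using Term by (auto simp: omega_mult_def)
    next
      case False
      have l: "last_exp c \<prec> a" using last_exp_le_lead Term False by blast
      have g: "\<not> last_exp c \<prec> \<gamma>" using Term False by simp
      have "\<not> a \<prec> \<gamma>" "a \<noteq> \<gamma>" using l g cless_trans by blast+
      then show ?thesis using Term False g by (auto simp: omega_mult_def)
    qed
  qed
  then show "init (\<beta> +\<^sub>o omega_power \<gamma>) = \<beta>" "last_exp (\<beta> +\<^sub>o omega_power \<gamma>) = \<gamma>" by auto
qed

lemma successor_iff: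
  assumes "nf \<gamma>" "\<gamma> \<noteq> Zero"
  shows "last_exp \<gamma> = Zero \<longleftrightarrow> (\<exists>\<delta>. nf \<delta> \<and> \<gamma> = \<delta> +\<^sub>o omega_power Zero)"
    and "last_exp \<gamma> = Zero \<Longrightarrow> \<gamma> = init \<gamma> +\<^sub>o omega_power Zero"
proof -
  show *: "last_exp \<gamma> = Zero \<Longrightarrow> \<gamma> = init \<gamma> +\<^sub>o omega_power Zero"
    using decomp(1)[OF assms] by simp
  show "last_exp \<gamma> = Zero \<longleftrightarrow> (\<exists>\<delta>. nf \<delta> \<and> \<gamma> = \<delta> +\<^sub>o omega_power Zero)"
    using * nf_init[OF assms(1)] decomp_unique(2)[of _ Zero] by fastforce
qed

text \<open>
  The natural numbers that occur in largeness statements have to be positive: at argument \<open>0\<close> the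
  value of a fundamental sequence may drop too far for the natural sum to be respected, as the
  following instance with \<open>\<omega>\<^sup>2\<close> and \<open>\<omega>\<^bsup>\<omega>\<^esup>\<close> shows.
\<close>

lemma zero_counterexample:
  defines "one \<equiv> omega_power Zero"
  defines "\<beta> \<equiv> omega_power (omega_mult Zero 2)" and "\<gamma> \<equiv> omega_power (omega_power one)"
  shows "at_most_large \<beta> {1, 2, 3, 4}" and "at_most_large \<gamma> {0, 5}"
    and "\<not> at_most_large (\<beta> \<oplus> \<gamma>) ({1, 2, 3, 4} \<union> {0, 5})"
proof -
  have d: "{1, 2, 3, 4::nat} - {4} = {1, 2, 3}" "{0, 5::nat} - {5} = {0}"
    "insert 0 {1, 2, 3, 4, 5::nat} - {5} = {0, 1, 2, 3, 4}" by auto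
  have u: "{1, 2, 3, 4::nat} \<union> {0, 5} = {0, 1, 2, 3, 4, 5}" by auto
  note defs = at_most_large_def small_def large_def fs_set_def one_def \<beta>_def \<gamma>_def
    omega_mult_def fs.simps Let_def
  show "at_most_large \<beta> {1, 2, 3, 4}" using d(1) by (simp add: defs)
  show "at_most_large \<gamma> {0, 5}" using d(2) by (simp add: defs)
  show "\<not> at_most_large (\<beta> \<oplus> \<gamma>) ({1, 2, 3, 4} \<union> {0, 5})"
    unfolding u using d(3) by (simp add: defs)
qed

end

theory Submission
  imports Defs
begin

text \<open>
  If \<open>x\<close> is the least element of \<open>B \<union> C\<close>, then passing from \<open>\<beta> \<oplus> \<gamma>\<close> to its \<open>x\<close>-th fundamental term
  reduces the summand with the smaller last exponent, whereas membership of \<open>x\<close> in \<open>B\<close> or \<open>C\<close> may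
  ask for the other one. So everything rests on an exchange argument: reducing a larger power
  \<open>\<omega>\<^bsup>b\<^esup>\<close> instead of the last one \<open>\<omega>\<^bsup>c\<^esup>\<close> never makes the process last longer.

  In the process that reduces \<open>\<omega>\<^bsup>c\<^esup>\<close>, the power \<open>\<omega>\<^bsup>b\<^esup>\<close> stays untouched until the part \<open>L\<close> below it is used
  up. One step with a positive argument lowers the total number of symbols of \<open>L\<close> (its weight) by
  at most one, so by then the argument has grown to at least \<open>y = x + weight L + 1\<close>, which is large
  enough for \<open>\<omega>\<^bsup>b\<^esup>\<close> to descend, by steps with the fixed argument \<open>y\<close>, to everything below \<open>\<omega>\<^bsup>b\<^esup>\<close> that
  the other process started with.
\<close>

subsection \<open>Normal forms, natural sums and fundamental sequences\<close>

text \<open>Keeps \<open>omega_mult a 1\<close>, which \<open>omega_power a\<close> abbreviates,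
  from being rewritten to a form with \<open>Suc 0\<close>.\<close>

declare One_nat_def [simp del]

lemma cless_asym: "a \<prec> b \<Longrightarrow> \<not> b \<prec> a"
  using cless_trans cless_irrefl by blast

fun coef :: "cnf \<Rightarrow> cnf \<Rightarrow> nat" where
  "coef Zero e = 0"
| "coef (Term a n c) e = (if e = a then n else 0) + coef c e"

fun exps :: "cnf \<Rightarrow> cnf set" where
  "exps Zero = {}"
| "exps (Term a n c) = insert a (exps c)"

lemma lead_less_iff: "nf c \<Longrightarrow> lead_less c a \<longleftrightarrow> (\<forall>e\<in>exps c. e \<prec> a)"
proof (induction c arbitrary: a)
  case (Term b n d)
  then show ?case by (auto intro: cless_trans)
qed simp

lemma coef_eq_0: "(\<And>e'. e' \<in> exps \<alpha> \<Longrightarrow> e' \<noteq> e) \<Longrightarrow> coef \<alpha> e = 0"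
  by (induction \<alpha>) auto

lemma coef_tail_eq_0: "nf (Term a n c) \<Longrightarrow> \<not> e \<prec> a \<Longrightarrow> coef c e = 0"
  using lead_less_iff[of c a] by (intro coef_eq_0) auto

text \<open>The leading exponents agree, since the larger one would have coefficient zero on the
  other side; then the leading coefficients and, by induction, the tails agree. As
  \<open>coef\<close> turns \<open>\<oplus>\<close> into addition of numbers, rearrangements of
  natural sums can be checked coefficientwise.\<close>

lemma cnf_eqI:
  assumes "nf \<alpha>" "nf \<beta>" "\<And>e. coef \<alpha> e = coef \<beta> e"
  shows "\<alpha> = \<beta>"
  using assms
proof (induction \<alpha> arbitrary: \<beta>)
  case Zero
  then show ?case
  proof (cases \<beta>)
    case (Term a n c)
    then show ?thesis using Zero.prems(2) Zero.prems(3)[of a] by simp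
  qed simp
next
  case (Term a n c)
  show ?case
  proof (cases \<beta>)
    case Zero
    then show ?thesis using Term.prems(1) Term.prems(3)[of a] by simp
  next
    case (Term a' n' c')
    note eq = Term.prems(3)[unfolded Term]
    note tail = coef_tail_eq_0[OF Term.prems(1)] coef_tail_eq_0[OF Term.prems(2)[unfolded Term]]
    have pos: "n \<ge> 1" "n' \<ge> 1" using Term.prems(1,2) Term by auto
    have aa: "a = a'"
      using eq[of a] eq[of a'] tail(1)[of a'] tail(2)[of a] pos cless_total[of a a'] cless_asym[of a a']
      by (auto split: if_splits)
    have nn: "n = n'" using eq[of a] tail(1)[of a] tail(2)[of a] aa by simp
    have "coef c e = coef c' e" for e using eq[of e] aa nn by simp
    then have "c = c'" using Term.IH(2)[of c'] Term.prems(1,2) Term by simp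
    then show ?thesis using aa nn Term by simp
  qed
qed

lemma coef_hsum [simp]: "coef (\<alpha> \<oplus> \<beta>) e = coef \<alpha> e + coef \<beta> e"
  by (induction \<alpha> \<beta> rule: hsum.induct) auto

lemma exps_hsum [simp]: "exps (\<alpha> \<oplus> \<beta>) = exps \<alpha> \<union> exps \<beta>"
  by (induction \<alpha> \<beta> rule: hsum.induct) auto

lemma hsum_Zero_right [simp]: "\<alpha> \<oplus> Zero = \<alpha>"
  by (cases \<alpha>) auto

lemma hsum_eq_Zero_iff [simp]: "\<alpha> \<oplus> \<beta> = Zero \<longleftrightarrow> \<alpha> = Zero \<and> \<beta> = Zero"
  by (cases \<alpha>; cases \<beta>) auto

lemma hsum_commute: "nf \<alpha> \<Longrightarrow> nf \<beta> \<Longrightarrow> \<alpha> \<oplus> \<beta> = \<beta> \<oplus> \<alpha>"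
  by (rule cnf_eqI) (auto simp: nf_hsum)

lemma hsum_assoc: "nf \<alpha> \<Longrightarrow> nf \<beta> \<Longrightarrow> nf \<gamma> \<Longrightarrow> \<alpha> \<oplus> \<beta> \<oplus> \<gamma> = \<alpha> \<oplus> (\<beta> \<oplus> \<gamma>)"
  by (rule cnf_eqI) (auto simp: nf_hsum)

lemma omega_mult_0 [simp]: "omega_mult a 0 = Zero"
  by (simp add: omega_mult_def)

lemma omega_mult_eq_Zero_iff [simp]: "omega_mult a n = Zero \<longleftrightarrow> n = 0"
  by (simp add: omega_mult_def)

lemma coef_omega_mult [simp]: "coef (omega_mult a n) e = (if e = a then n else 0)"
  by (simp add: omega_mult_def)

lemma exps_omega_mult: "exps (omega_mult a n) = (if n = 0 then {} else {a})"
  by (simp add: omega_mult_def)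

lemma omega_mult_add: "omega_mult a (m + n) = omega_mult a m \<oplus> omega_mult a n"
  by (simp add: omega_mult_def)

lemma Term_eq_hsum: "nf (Term a n c) \<Longrightarrow> Term a n c = omega_mult a n \<oplus> c"
  by (rule cnf_eqI) (auto simp: nf_hsum nf_omega_mult)

lemmas nf_intros = nf_hsum nf_omega_mult nf_fs nf_init nf_last_exp

text \<open>The hypothesis on the exponents excludes that terms on the left are absorbed. This
  allows \<open>fs\<close>, which is defined with \<open>+\<^sub>o\<close>, to be computed with
  \<open>\<oplus>\<close>.\<close>

lemma oadd_eq_hsum:
  assumes "nf \<alpha>" "nf \<beta>" "\<forall>a\<in>exps \<alpha>. \<forall>b\<in>exps \<beta>. \<not> a \<prec> b"
  shows "\<alpha> +\<^sub>o \<beta> = \<alpha> \<oplus> \<beta>"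
  using assms
proof (induction \<alpha> \<beta> rule: oadd.induct)
  case (3 a n b a' n' b')
  show ?case
  proof (cases "a = a'")
    case True
    have "b = Zero"
      using "3.prems" True lead_less_iff[of b a] cless_asym by (cases b) auto
    then show ?thesis using True by simp
  next
    case False
    then have "a' \<prec> a" "\<not> a \<prec> a'" using "3.prems" cless_total[of a a'] by auto
    then show ?thesis using 3 False by simp
  qed
qed auto

lemma exps_init_subset: "exps (init \<alpha>) \<subseteq> exps \<alpha>"
  by (induction \<alpha>) (auto simp: exps_omega_mult)

lemma last_exp_in_exps: "\<alpha> \<noteq> Zero \<Longrightarrow> last_exp \<alpha> \<in> exps \<alpha>"
  by (induction \<alpha>) auto

lemma last_exp_le: "nf \<alpha> \<Longrightarrow> e \<in> exps \<alpha> \<Longrightarrow> \<not> e \<prec> last_exp \<alpha>"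
proof (induction \<alpha>)
  case (Term a n c)
  then show ?case using last_exp_le_lead[of a n c] cless_asym by auto
qed simp

lemma last_exp_init_le: "nf \<alpha> \<Longrightarrow> e \<in> exps (init \<alpha>) \<Longrightarrow> \<not> e \<prec> last_exp \<alpha>"
  using last_exp_le exps_init_subset by blast

lemma init_hsum_last_exp:
  assumes "nf \<alpha>" "\<alpha> \<noteq> Zero"
  shows "\<alpha> = init \<alpha> \<oplus> omega_power (last_exp \<alpha>)"
  using decomp(1)[OF assms] oadd_eq_hsum[of "init \<alpha>" "omega_power (last_exp \<alpha>)"]
    last_exp_init_le[OF assms(1)] assms(1) by (auto simp: nf_intros exps_omega_mult)

lemma init_last_exp_unique:
  assumes "nf \<beta>" "nf g" "\<forall>e\<in>exps \<beta>. \<not> e \<prec> g"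
  shows "init (\<beta> \<oplus> omega_power g) = \<beta>" "last_exp (\<beta> \<oplus> omega_power g) = g"
proof -
  have "\<beta> +\<^sub>o omega_power g = \<beta> \<oplus> omega_power g"
    using assms by (intro oadd_eq_hsum) (auto simp: nf_intros exps_omega_mult)
  then show "init (\<beta> \<oplus> omega_power g) = \<beta>" "last_exp (\<beta> \<oplus> omega_power g) = g"
    using decomp_unique[OF assms(1,2)] assms(3) last_exp_in_exps[of \<beta>] by (metis)+
qed

section \<open>One step of a fundamental sequence\<close>

lemma fs_Zero [simp]: "fs Zero x = Zero"
  by (simp add: fs.simps)

lemma fs_omega_power_Zero [simp]: "fs (omega_power Zero) x = Zero"
  by (subst fs.simps) (simp add: omega_mult_def)

lemma fs_omega_power_succ:
  "g \<noteq> Zero \<Longrightarrow> last_exp g = Zero \<Longrightarrow> fs (omega_power g) x = omega_mult (init g) x"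
  by (subst fs.simps) (simp add: omega_mult_def)

lemma fs_omega_power_limit:
  "last_exp g \<noteq> Zero \<Longrightarrow> fs (omega_power g) x = omega_power (fs g x)"
  by (subst fs.simps) (auto simp: omega_mult_def)

lemma fs_succ: "\<alpha> \<noteq> Zero \<Longrightarrow> last_exp \<alpha> = Zero \<Longrightarrow> fs \<alpha> x = init \<alpha>"
  by (subst fs.simps) simp

text \<open>All clauses of \<open>fs\<close> act on the last power alone, so it suffices to know the
  fundamental sequences of single powers.\<close>

lemma fs_eq_oadd:
  "\<alpha> \<noteq> Zero \<Longrightarrow> fs \<alpha> x = init \<alpha> +\<^sub>o fs (omega_power (last_exp \<alpha>)) x"
proof -
  have [simp]: "a +\<^sub>o Zero = a" for a by (cases a) auto
  show "\<alpha> \<noteq> Zero \<Longrightarrow> ?thesis"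
    by (cases "last_exp \<alpha> = Zero"; cases "last_exp (last_exp \<alpha>) = Zero")
      (subst fs.simps; auto simp: fs_omega_power_succ fs_omega_power_limit)+
qed

lemma init_cless:
  assumes "nf g" "g \<noteq> Zero"
  shows "init g \<prec> g"
  using assms
proof (induction g)
  case (Term a n c)
  then show ?case by (auto simp: omega_mult_def)
qed simp

text \<open>The bound on the exponents prevents the new last part from absorbing
  \<open>Term a n\<close>. It is a hypothesis because the lemma is used inside the induction that
  proves the bound.\<close>

lemma fs_Term_tail:
  assumes "nf (Term a n c)" "c \<noteq> Zero" "\<forall>e\<in>exps (fs (omega_power (last_exp c)) x). e \<prec> last_exp c"
  shows "fs (Term a n c) x = Term a n (fs c x)"
proof -
  have "Term a n d +\<^sub>o p = Term a n (d +\<^sub>o p)" if "\<forall>e\<in>exps p. e \<prec> a" for d p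
    using that cless_asym by (cases p; cases d) auto
  moreover have "\<forall>e\<in>exps (fs (omega_power (last_exp c)) x). e \<prec> a"
    using assms last_exp_le_lead cless_trans by blast
  ultimately show ?thesis using assms(2) fs_eq_oadd[of "Term a n c" x] fs_eq_oadd[of c x] by simp
qed

text \<open>The only exponent that can occur in \<open>fs (omega_power \<alpha>) x\<close> is
  \<open>fs \<alpha> x\<close>, so the first claim follows from the second; the second uses the
  first for exponents of smaller size inside \<open>\<alpha>\<close>.\<close>

lemma exps_fs_omega_power_and_fs_less:
  "nf \<alpha> \<Longrightarrow> (\<forall>e\<in>exps (fs (omega_power \<alpha>) x). e \<prec> \<alpha>) \<and> (\<alpha> \<noteq> Zero \<longrightarrow> fs \<alpha> x \<prec> \<alpha>)"
proof (induction "size \<alpha>" arbitrary: \<alpha> rule: less_induct)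
  case less
  have main: "\<alpha> \<noteq> Zero \<longrightarrow> fs \<alpha> x \<prec> \<alpha>"
  proof (cases \<alpha>)
    case (Term a n c)
    show ?thesis
    proof (cases "c = Zero")
      case False
      then have "\<forall>e\<in>exps (fs (omega_power (last_exp c)) x). e \<prec> last_exp c" "fs c x \<prec> c"
        using less Term size_last_exp[OF False] by (auto simp: nf_last_exp)
      then show ?thesis using fs_Term_tail[of a n c x] less.prems Term False by simp
    next
      case True
      have e: "\<forall>e\<in>exps (fs (omega_power a) x). e \<prec> a" using less Term by simp
      have "fs \<alpha> x = omega_mult a (n - 1) +\<^sub>o fs (omega_power a) x"
        using Term True fs_eq_oadd[of \<alpha> x] by simp
      then show ?thesis using e Term True less.prems cless_asym
        by (cases "fs (omega_power a) x") (auto simp: omega_mult_def)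
    qed
  qed simp
  then show ?case
    by (cases "\<alpha> = Zero"; cases "last_exp \<alpha> = Zero")
      (auto simp: fs_omega_power_succ fs_omega_power_limit exps_omega_mult fs_succ)
qed

lemma exps_fs_omega_power: "nf g \<Longrightarrow> e \<in> exps (fs (omega_power g) x) \<Longrightarrow> e \<prec> g"
  using exps_fs_omega_power_and_fs_less by blast

lemma fs_less: "nf \<alpha> \<Longrightarrow> \<alpha> \<noteq> Zero \<Longrightarrow> fs \<alpha> x \<prec> \<alpha>"
  using exps_fs_omega_power_and_fs_less by blast

lemma fs_Term_Cons:
  "nf (Term a n c) \<Longrightarrow> c \<noteq> Zero \<Longrightarrow> fs (Term a n c) x = Term a n (fs c x)"
  using fs_Term_tail exps_fs_omega_power[of "last_exp c"] by (auto simp: nf_last_exp)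

lemma fs_Term_Zero:
  assumes "nf (Term a n Zero)"
  shows "fs (Term a n Zero) x =
    (if n = 1 then fs (omega_power a) x else Term a (n - 1) (fs (omega_power a) x))"
proof -
  have "fs (Term a n Zero) x = omega_mult a (n - 1) +\<^sub>o fs (omega_power a) x"
    using fs_eq_oadd[of "Term a n Zero" x] by simp
  then show ?thesis
    using assms exps_fs_omega_power[of a _ x] cless_asym[of a]
    by (cases "fs (omega_power a) x") (auto simp: omega_mult_def)
qed

lemma fs_hsum_omega_power:
  assumes "nf \<beta>" "nf g" "\<forall>e\<in>exps \<beta>. \<not> e \<prec> g"
  shows "fs (\<beta> \<oplus> omega_power g) x = \<beta> \<oplus> fs (omega_power g) x"
proof -
  have "fs (\<beta> \<oplus> omega_power g) x = \<beta> +\<^sub>o fs (omega_power g) x"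
    using fs_eq_oadd[of "\<beta> \<oplus> omega_power g" x] init_last_exp_unique[OF assms] by simp
  also have "\<dots> = \<beta> \<oplus> fs (omega_power g) x"
  proof (rule oadd_eq_hsum)
    show "\<forall>a\<in>exps \<beta>. \<forall>b\<in>exps (fs (omega_power g) x). \<not> a \<prec> b"
      using assms(3) exps_fs_omega_power[OF assms(2), of _ x] cless_trans by blast
  qed (use assms in \<open>auto simp: nf_intros\<close>)
  finally show ?thesis .
qed

lemma fs_eq_hsum:
  assumes "nf \<alpha>" "\<alpha> \<noteq> Zero"
  shows "fs \<alpha> x = init \<alpha> \<oplus> fs (omega_power (last_exp \<alpha>)) x"
  using fs_hsum_omega_power[of "init \<alpha>" "last_exp \<alpha>" x] init_hsum_last_exp[OF assms]
    last_exp_init_le assms(1) by (simp add: nf_intros)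

text \<open>The last power of \<open>\<beta> \<oplus> \<gamma>\<close> can be taken from
  \<open>\<gamma>\<close>, so \<open>\<beta>\<close> stays inert. With equal last exponents either
  summand may be the one that is reduced.\<close>

lemma fs_hsum:
  assumes "nf \<beta>" "nf \<gamma>" "\<gamma> \<noteq> Zero" "\<forall>e\<in>exps \<beta>. \<not> e \<prec> last_exp \<gamma>"
  shows "fs (\<beta> \<oplus> \<gamma>) x = \<beta> \<oplus> fs \<gamma> x"
proof -
  have "\<beta> \<oplus> \<gamma> = \<beta> \<oplus> init \<gamma> \<oplus> omega_power (last_exp \<gamma>)"
    using init_hsum_last_exp[OF assms(2,3)] assms(1,2)
    by (metis hsum_assoc nf_init nf_last_exp nf_omega_mult)
  also have "fs \<dots> x = \<beta> \<oplus> init \<gamma> \<oplus> fs (omega_power (last_exp \<gamma>)) x"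
    using assms last_exp_init_le by (intro fs_hsum_omega_power) (auto simp: nf_intros)
  also have "\<dots> = \<beta> \<oplus> fs \<gamma> x"
    using assms fs_eq_hsum[of \<gamma> x] by (simp add: hsum_assoc nf_intros)
  finally show ?thesis .
qed

lemma exps_fs: "nf \<alpha> \<Longrightarrow> e \<in> exps (fs \<alpha> x) \<Longrightarrow> \<exists>a\<in>exps \<alpha>. e = a \<or> e \<prec> a"
  using exps_init_subset[of \<alpha>] exps_fs_omega_power[of "last_exp \<alpha>" e x] last_exp_in_exps[of \<alpha>]
    fs_eq_hsum[of \<alpha> x]
  by (cases "\<alpha> = Zero") (auto simp: nf_last_exp)

subsection \<open>Coefficients and weights\<close>

fun max_coef :: "cnf \<Rightarrow> nat" where
  "max_coef Zero = 0"
| "max_coef (Term a n c) = max (max_coef a) (max n (max_coef c))"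

text \<open>Counts the occurrences of omega, also in exponents, when every coefficient is written
  out as a repeated sum.\<close>

fun weight :: "cnf \<Rightarrow> nat" where
  "weight Zero = 0"
| "weight (Term a n c) = n * (weight a + 1) + weight c"

lemma weight_hsum [simp]: "weight (\<alpha> \<oplus> \<beta>) = weight \<alpha> + weight \<beta>"
  by (induction \<alpha> \<beta> rule: hsum.induct) (auto simp: algebra_simps)

lemma weight_omega_mult [simp]: "weight (omega_mult a n) = n * (weight a + 1)"
  by (simp add: omega_mult_def)

lemma max_coef_le_weight: "nf \<alpha> \<Longrightarrow> max_coef \<alpha> \<le> weight \<alpha>"
proof (induction \<alpha>)
  case (Term a n c)
  then have "weight a + 1 \<le> n * (weight a + 1)" using mult_le_mono1[of 1 n "weight a + 1"] by simp
  moreover have "n \<le> n * (weight a + 1)" by simp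
  moreover have "max_coef a \<le> weight a" "max_coef c \<le> weight c" using Term by auto
  ultimately show ?case
    unfolding max_coef.simps weight.simps max.bounded_iff by linarith
qed simp

lemma weight_omega_power_le_fs_if:
  assumes "nf g" "1 \<le> x" "g \<noteq> Zero \<Longrightarrow> weight g \<le> weight (fs g x) + 1"
  shows "weight (omega_power g) \<le> weight (fs (omega_power g) x) + 1"
proof -
  consider "g = Zero" | "g \<noteq> Zero" "last_exp g = Zero" | "g \<noteq> Zero" "last_exp g \<noteq> Zero" by auto
  then show ?thesis
  proof cases
    case 2
    have "weight g \<le> weight (init g) + 1" using assms(3) 2 by (simp add: fs_succ)
    \<comment> \<open>Here \<open>1 \<le> x\<close> matters: at least one copy of the power with the
      predecessor exponent survives.\<close>
    also have "\<dots> \<le> x * (weight (init g) + 1)"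
      using assms(2) mult_le_mono1[of 1 x "weight (init g) + 1"] by simp
    finally show ?thesis using 2 by (simp add: fs_omega_power_succ)
  qed (use assms in \<open>auto simp: fs_omega_power_limit\<close>)
qed

text \<open>Only the last power changes: with exponent 0 it has weight one, a successor exponent
  loses one symbol, and a limit exponent passes the step on to an ordinal of smaller size.\<close>

lemma weight_le_fs: "nf \<alpha> \<Longrightarrow> 1 \<le> x \<Longrightarrow> weight \<alpha> \<le> weight (fs \<alpha> x) + 1"
proof (induction "size \<alpha>" arbitrary: \<alpha> rule: less_induct)
  case less
  show ?case
  proof (cases "\<alpha> = Zero")
    case False
    let ?g = "last_exp \<alpha>"
    have "weight (omega_power ?g) \<le> weight (fs (omega_power ?g) x) + 1"
      using less size_last_exp[OF False] by (intro weight_omega_power_le_fs_if) (auto simp: nf_last_exp)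
    moreover have "weight \<alpha> = weight (init \<alpha>) + weight (omega_power ?g)"
      using init_hsum_last_exp[OF less.prems(1) False] weight_hsum by metis
    ultimately show ?thesis using fs_eq_hsum[OF less.prems(1) False] by simp
  qed simp
qed

lemma weight_omega_power_le_fs:
  "nf g \<Longrightarrow> 1 \<le> x \<Longrightarrow> weight (omega_power g) \<le> weight (fs (omega_power g) x) + 1"
  by (rule weight_le_fs) (auto simp: nf_intros)

section \<open>Comparing ordinals with fundamental terms\<close>

lemma cless_omega_mult [simp]:
  "\<delta> \<prec> omega_mult a n \<longleftrightarrow> n \<noteq> 0 \<and> (case \<delta> of Zero \<Rightarrow> True | Term s k r \<Rightarrow> s \<prec> a \<or> s = a \<and> k < n)"
  by (cases \<delta>) (auto simp: omega_mult_def)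

lemma omega_mult_cless_Term [simp]:
  "omega_mult a n \<prec> Term s k r \<longleftrightarrow> n = 0 \<or> a \<prec> s \<or> a = s \<and> (n < k \<or> n = k \<and> r \<noteq> Zero)"
  by (auto simp: omega_mult_def cless_Zero_iff)

lemma max_coef_omega_mult [simp]:
  "max_coef (omega_mult a n) = (if n = 0 then 0 else max (max_coef a) n)"
  by (simp add: omega_mult_def)

text \<open>A lowered successor exponent receives the coefficient \<open>y\<close>, which beats all
  coefficients of \<open>\<delta>\<close>. Strictness at limits carries the induction through
  exponents: \<open>omega_power (fs a y)\<close> exceeds a term with leading exponent
  \<open>s\<close> only if \<open>s \<prec> fs a y\<close>.\<close>

lemma cless_fs_aux:
  assumes "nf \<alpha>" "nf \<delta>" "\<delta> \<prec> \<alpha>" "max_coef \<delta> < y"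
  shows "(\<delta> = fs \<alpha> y \<or> \<delta> \<prec> fs \<alpha> y) \<and> (last_exp \<alpha> \<noteq> Zero \<longrightarrow> \<delta> \<prec> fs \<alpha> y)"
  using assms
proof (induction \<alpha> arbitrary: \<delta>)
  case (Term a n c)
  show ?case
  proof (cases "c = Zero")
    case False
    then show ?thesis using Term.IH(2) Term.prems fs_Term_Cons[OF Term.prems(1) False]
      by (cases \<delta>) auto
  next
    case True
    \<comment> \<open>One power suffices: \<open>lead_less d a\<close> says that \<open>d\<close>
      lies below \<open>omega_power a\<close>; the number of earlier copies is compared
      afterwards.\<close>
    have pow: "(a = Zero \<longrightarrow> d = Zero) \<and> (a \<noteq> Zero \<longrightarrow> d \<prec> fs (omega_power a) y)"
      if d: "nf d" "lead_less d a" "max_coef d < y" for d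
    proof (cases d)
      case Zero
      then show ?thesis using d
        by (cases "last_exp a = Zero")
          (auto simp: fs_omega_power_succ fs_omega_power_limit)
    next
      case (Term s k r)
      then have s: "nf s" "s \<prec> a" "max_coef s < y" "k < y" using d by auto
      then have ih: "s = fs a y \<or> s \<prec> fs a y" "last_exp a \<noteq> Zero \<longrightarrow> s \<prec> fs a y"
        using Term.IH(1) \<open>nf (cnf.Term a n c)\<close> by auto
      show ?thesis
        using s ih Term
        by (cases "a = Zero"; cases "last_exp a = Zero")
          (auto simp: fs_omega_power_succ fs_omega_power_limit fs_succ)
    qed
    have nfa: "nf (Term a n Zero)" using Term.prems True by simp
    show ?thesis
    proof (cases \<delta>)
      case Zero
      then show ?thesis using pow[of Zero] Term.prems True fs_Term_Zero[OF nfa, of y] by auto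
    next
      case d: (Term a' n' c')
      consider "a' \<prec> a" | "a' = a" "n' < n - 1" | "a' = a" "n' = n - 1" "n' \<ge> 1"
        using Term.prems d True by fastforce
      then show ?thesis
      proof cases
        case 1
        then show ?thesis
          using pow[of \<delta>] Term.prems d True fs_Term_Zero[OF nfa, of y] by auto
      next
        case 2
        then show ?thesis
          using Term.prems d True fs_Term_Zero[OF nfa, of y] by auto
      next
        case 3
        then show ?thesis
          using pow[of c'] Term.prems d True fs_Term_Zero[OF nfa, of y] by auto
      qed
    qed
  qed
qed simp

lemma cless_fs:
  "nf \<alpha> \<Longrightarrow> nf \<delta> \<Longrightarrow> \<delta> \<prec> \<alpha> \<Longrightarrow> max_coef \<delta> < y \<Longrightarrow> \<delta> = fs \<alpha> y \<or> \<delta> \<prec> fs \<alpha> y"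
  using cless_fs_aux by blast

lemma cless_succ:
  assumes "nf g" "last_exp g = Zero" "nf s" "s \<prec> g"
  shows "s = init g \<or> s \<prec> init g"
  \<comment> \<open>At a successor \<open>fs g y\<close> does not depend on \<open>y\<close>, so the
    argument may be chosen above all coefficients of \<open>s\<close>.\<close>
  using assms cless_fs[of g s "max_coef s + 1"] by (cases "g = Zero") (auto simp: fs_succ)

text \<open>An ordinal in this gap shares the part of \<open>\<alpha>\<close> before its last power;
  the new last power has coefficient \<open>x\<close> or 1, and its exponent is handled by
  induction.\<close>

lemma max_coef_fs_between:
  assumes "nf \<alpha>" "nf \<delta>" "fs \<alpha> x \<prec> \<delta>" "\<delta> \<prec> \<alpha>"
  shows "max_coef (fs \<alpha> x) \<le> max x (max_coef \<delta>)"
  using assms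
proof (induction \<alpha> arbitrary: \<delta>)
  case (Term a n c)
  obtain a' n' c' where d: "\<delta> = Term a' n' c'" using Term.prems by (cases \<delta>) auto
  show ?case
  proof (cases "c = Zero")
    case False
    note fs = fs_Term_Cons[OF Term.prems(1) False, of x]
    have eq: "a' = a" "n' = n" "fs c x \<prec> c'" "c' \<prec> c"
      using Term.prems(3,4) d fs cless_asym by auto
    then have "max_coef (fs c x) \<le> max x (max_coef c')" using Term.IH(2) Term.prems d by auto
    then show ?thesis using fs d eq by auto
  next
    case True
    have nfa: "nf (Term a n Zero)" using Term.prems True by simp
    note fs = fs_Term_Zero[OF nfa, of x]
    have pow: "max_coef (fs (omega_power a) x) \<le> max x (max_coef d)"
      if d: "nf d" "lead_less d a" "fs (omega_power a) x \<prec> d" for d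
    proof (cases d)
      case Zero
      then show ?thesis using d by simp
    next
      case (Term s k r)
      then have s: "nf s" "s \<prec> a" using d by auto
      have "a \<noteq> Zero" using s by auto
      show ?thesis
      proof (cases "last_exp a = Zero \<and> x = 0")
        case True
        then show ?thesis using \<open>a \<noteq> Zero\<close> by (simp add: fs_omega_power_succ)
      next
        case False
        have "fs a x = s \<or> fs a x \<prec> s"
          using d(3) Term \<open>a \<noteq> Zero\<close> False
          by (cases "last_exp a = Zero")
            (auto simp: fs_omega_power_succ fs_omega_power_limit fs_succ)
        then have "max_coef (fs a x) \<le> max x (max_coef s)"
          using Term.IH(1)[of s] s nfa by auto
        moreover have "1 \<le> k" using d Term by simp
        ultimately show ?thesis using Term \<open>a \<noteq> Zero\<close> False
          by (cases "last_exp a = Zero")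
            (auto simp: fs_omega_power_succ fs_omega_power_limit fs_succ)
      qed
    qed
    show ?thesis
    proof (cases "n = 1")
      case n: True
      then have "a' \<prec> a" using Term.prems d True by auto
      then show ?thesis using pow[of \<delta>] Term.prems d True fs n by simp
    next
      case n: False
      then have "a' = a" "n' = n - 1" "fs (omega_power a) x \<prec> c'"
        using Term.prems d True fs cless_asym by auto
      then show ?thesis using pow[of c'] Term.prems d True fs n by auto
    qed
  qed
qed simp

subsection \<open>Descending at a fixed argument\<close>

text \<open>The arrow relation of Ketonen and Solovay in its reflexive form. Runs along increasing
  arguments that are at least \<open>y\<close> respect it (\<open>foldl_fs_reach\<close>).\<close>

definition reach :: "nat \<Rightarrow> cnf \<Rightarrow> cnf \<Rightarrow> bool" where
  "reach y = (\<lambda>\<alpha> \<beta>. \<beta> = fs \<alpha> y)\<^sup>*\<^sup>*"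

lemma reach_refl [simp]: "reach y \<alpha> \<alpha>"
  by (simp add: reach_def)

lemma reach_trans: "reach y \<alpha> \<beta> \<Longrightarrow> reach y \<beta> \<gamma> \<Longrightarrow> reach y \<alpha> \<gamma>"
  unfolding reach_def by (rule rtranclp_trans)

lemma reach_step: "reach y \<alpha> (fs \<alpha> y)"
  unfolding reach_def by (rule r_into_rtranclp) simp

lemma reach_induct [consumes 1, case_names refl step]:
  assumes "reach y \<alpha> \<beta>" "P \<beta>"
    and "\<And>\<delta>. reach y (fs \<delta> y) \<beta> \<Longrightarrow> P (fs \<delta> y) \<Longrightarrow> P \<delta>"
  shows "P \<alpha>"
  using assms unfolding reach_def by (induction rule: converse_rtranclp_induct) auto

lemma nf_reach: "reach y \<alpha> \<beta> \<Longrightarrow> nf \<alpha> \<Longrightarrow> nf \<beta>"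
  by (induction rule: reach_induct) (auto simp: nf_fs)

lemma reach_cases: "reach y \<alpha> \<beta> \<Longrightarrow> \<beta> = \<alpha> \<or> reach y (fs \<alpha> y) \<beta>"
  unfolding reach_def by (erule converse_rtranclpE) auto

lemma reach_Zero_iff: "reach y Zero \<beta> \<longleftrightarrow> \<beta> = Zero"
proof
  show "reach y Zero \<beta> \<Longrightarrow> \<beta> = Zero"
    unfolding reach_def by (induction rule: rtranclp_induct) auto
qed simp

lemma nf_wf_induct [consumes 1, case_names less]:
  assumes "nf \<alpha>" "\<And>\<alpha>. nf \<alpha> \<Longrightarrow> (\<And>\<beta>. nf \<beta> \<Longrightarrow> \<beta> \<prec> \<alpha> \<Longrightarrow> P \<beta>) \<Longrightarrow> P \<alpha>"
  shows "P \<alpha>"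
  using assms(1)
proof (induction \<alpha> rule: wfp_induct_rule[OF wfp_cless_nf])
  case (1 \<alpha>)
  then show ?case using assms(2)[of \<alpha>] by blast
qed

lemma reach_Zero: "nf \<alpha> \<Longrightarrow> reach y \<alpha> Zero"
proof (induction \<alpha> rule: nf_wf_induct)
  case (less \<alpha>)
  then show ?case
    using fs_less[of \<alpha> y] nf_fs[of \<alpha> y] reach_trans[OF reach_step] by (cases "\<alpha> = Zero") auto
qed

lemma reach_hsum:
  assumes "reach y \<alpha> \<delta>" "nf \<alpha>" "nf \<beta>" "\<forall>b\<in>exps \<beta>. \<forall>a\<in>exps \<alpha>. \<not> b \<prec> a"
  shows "reach y (\<beta> \<oplus> \<alpha>) (\<beta> \<oplus> \<delta>)"
  using assms
proof (induction rule: reach_induct)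
  case (step \<alpha>)
  show ?case
  \<comment> \<open>Once \<open>\<alpha>\<close> is used up a further step would eat into
    \<open>\<beta>\<close>, but then \<open>\<delta>\<close> is \<open>Zero\<close> too and no step
    is taken.\<close>
  proof (cases "\<alpha> = Zero")
    case True
    then show ?thesis using step.hyps reach_Zero_iff by simp
  next
    case False
    have "\<forall>b\<in>exps \<beta>. \<forall>a\<in>exps (fs \<alpha> y). \<not> b \<prec> a"
      using step.prems exps_fs[OF step.prems(1), of _ y] cless_trans by blast
    then have "reach y (\<beta> \<oplus> fs \<alpha> y) (\<beta> \<oplus> \<delta>)" using step nf_fs by blast
    moreover have "fs (\<beta> \<oplus> \<alpha>) y = \<beta> \<oplus> fs \<alpha> y"
      using step.prems False last_exp_in_exps by (intro fs_hsum) auto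
    ultimately show ?thesis using reach_trans reach_step by metis
  qed
qed simp

lemma reach_omega_mult:
  assumes "nf a" "m \<le> n"
  shows "reach y (omega_mult a n) (omega_mult a m)"
proof -
  have "omega_mult a n = omega_mult a m \<oplus> omega_mult a (n - m)"
    using omega_mult_add[of a m "n - m"] assms by simp
  moreover have "reach y \<dots> (omega_mult a m \<oplus> Zero)"
    using assms by (intro reach_hsum reach_Zero) (auto simp: nf_intros exps_omega_mult)
  ultimately show ?thesis by simp
qed

text \<open>A successor exponent turns the power into \<open>y\<close> copies of the one below, of
  which all but one are removed. At a limit exponent a step is passed on directly.\<close>

lemma reach_omega_power:
  assumes "reach y \<gamma> \<delta>" "nf \<gamma>" "1 \<le> y"
  shows "reach y (omega_power \<gamma>) (omega_power \<delta>)"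
  using assms
proof (induction rule: reach_induct)
  case (step \<gamma>)
  have "reach y (omega_power \<gamma>) (omega_power (fs \<gamma> y))"
  proof (cases "\<gamma> = Zero \<or> last_exp \<gamma> \<noteq> Zero")
    case True
    then show ?thesis using fs_omega_power_limit[of \<gamma> y] reach_step[of y "omega_power \<gamma>"] by auto
  next
    case False
    then have "reach y (omega_power \<gamma>) (omega_mult (init \<gamma>) y)"
      using fs_omega_power_succ[of \<gamma> y] reach_step[of y "omega_power \<gamma>"] by auto
    then show ?thesis
      using False step.prems reach_omega_mult[of "init \<gamma>" 1 y y] reach_trans
      by (auto simp: fs_succ nf_init)
  qed
  then show ?case using step reach_trans nf_fs by blast
qed simp

text \<open>At a successor exponent \<open>y - x\<close> of the \<open>y\<close> copies are removed;
  at a limit exponent the descent takes place in the exponent, by induction.\<close>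

lemma reach_fs:
  assumes "nf \<alpha>" "x \<le> y"
  shows "reach y \<alpha> (fs \<alpha> x)"
  using assms(1)
proof (induction "size \<alpha>" arbitrary: \<alpha> rule: less_induct)
  case less
  show ?case
  proof (cases "\<alpha> = Zero \<or> x = y")
    case False
    let ?g = "last_exp \<alpha>"
    have g: "nf ?g" "1 \<le> y" using less.prems nf_last_exp False assms(2) by auto
    have "reach y (omega_power ?g) (fs (omega_power ?g) x)"
    proof (cases "?g = Zero \<or> last_exp ?g \<noteq> Zero")
      case True
      have "reach y ?g (fs ?g x)" using less g False size_last_exp[of \<alpha>] by blast
      then have "reach y (omega_power ?g) (omega_power (fs ?g x))" using g reach_omega_power by blast
      then show ?thesis using True g fs_omega_power_limit[of ?g x] reach_Zero[of "omega_power ?g" y]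
        by (auto simp: nf_omega_mult)
    next
      case False
      then have "reach y (omega_power ?g) (omega_mult (init ?g) y)"
        using fs_omega_power_succ[of ?g y] reach_step[of y "omega_power ?g"] by auto
      then show ?thesis
        using False g reach_omega_mult[of "init ?g" x y y] assms(2) reach_trans
        by (auto simp: fs_omega_power_succ nf_init)
    qed
    then have "reach y (init \<alpha> \<oplus> omega_power ?g) (init \<alpha> \<oplus> fs (omega_power ?g) x)"
      using less.prems last_exp_init_le[of \<alpha>]
      by (intro reach_hsum) (auto simp: nf_intros exps_omega_mult)
    then show ?thesis
      using False less.prems init_hsum_last_exp[of \<alpha>] fs_eq_hsum[of \<alpha> x] by auto
  qed (auto simp: reach_step)
qed

lemma reach_mono: "reach y \<alpha> \<delta> \<Longrightarrow> nf \<alpha> \<Longrightarrow> y \<le> z \<Longrightarrow> reach z \<alpha> \<delta>"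
proof (induction rule: reach_induct)
  case (step \<alpha>)
  then show ?case using reach_fs[of \<alpha> y z] reach_trans nf_fs by blast
qed simp

text \<open>No step at \<open>y\<close> jumps over \<open>\<delta>\<close>, by
  \<open>cless_fs\<close>; since the values decrease strictly, the descent has to hit it.\<close>

lemma reach_of_cless:
  assumes "nf \<alpha>" "nf \<delta>" "\<delta> \<prec> \<alpha>" "max_coef \<delta> < y"
  shows "reach y \<alpha> \<delta>"
  using assms(1,3)
proof (induction \<alpha> rule: nf_wf_induct)
  case (less \<alpha>)
  have "\<alpha> \<noteq> Zero" using less.prems by auto
  then have "reach y (fs \<alpha> y) \<delta>"
    using cless_fs[of \<alpha> \<delta> y] less assms(2,4) fs_less[of \<alpha> y] nf_fs[of \<alpha> y] by auto
  then show ?case using reach_step reach_trans by blast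
qed

section \<open>What a single power reaches\<close>

lemma reach_omega_power_one:
  assumes "nf a" "2 \<le> y"
  shows "reach y (omega_power a) (omega_power Zero)"
proof (cases "a = Zero")
  case False
  then show ?thesis using assms
    by (intro reach_of_cless) (auto simp: nf_intros cless_Zero_iff omega_mult_def[of Zero])
qed simp

lemma succ_one:
  assumes "nf e"
  shows "last_exp (e \<oplus> omega_power Zero) = Zero" "init (e \<oplus> omega_power Zero) = e"
  using init_last_exp_unique[of e Zero] assms by auto

text \<open>The larger argument leaves a spare copy of a power, which descends to 1. As an exponent
  the result is a successor, so its power splits into \<open>y\<close> copies at the next
  step.\<close>

lemma reach_fs_succ:
  assumes "nf \<alpha>" "\<alpha> \<noteq> Zero" "last_exp \<alpha> \<noteq> Zero" "1 \<le> x" "x < y"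
  shows "reach y \<alpha> (fs \<alpha> x \<oplus> omega_power Zero)"
  using assms(1-3)
proof (induction "size \<alpha>" arbitrary: \<alpha> rule: less_induct)
  case less
  let ?g = "last_exp \<alpha>" and ?one = "omega_power Zero"
  have g: "nf ?g" "?g \<noteq> Zero" "1 \<le> y" "2 \<le> y" using less.prems nf_last_exp assms by auto
  have add_one: "reach y (omega_mult a n) (omega_mult a m \<oplus> ?one)" if "nf a" "m < n" for a m n
  proof -
    have "reach y (omega_mult a m \<oplus> omega_power a) (omega_mult a m \<oplus> ?one)"
      using that g by (intro reach_hsum reach_omega_power_one) (auto simp: nf_intros exps_omega_mult)
    then show ?thesis
      using reach_omega_mult[of a "m + 1" n y] that omega_mult_add[of a m 1] reach_trans by auto
  qed
  have "reach y (omega_power ?g) (fs (omega_power ?g) x \<oplus> ?one)"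
  proof (cases "last_exp ?g = Zero")
    case True
    then have "reach y (omega_power ?g) (omega_mult (init ?g) y)"
      using g fs_omega_power_succ[of ?g y] reach_step[of y "omega_power ?g"] by auto
    then show ?thesis
      using True g add_one[of "init ?g" x y] assms(5) reach_trans
      by (auto simp: fs_omega_power_succ nf_init)
  next
    case False
    let ?e = "fs ?g x"
    have "reach y ?g (?e \<oplus> ?one)" using less g False size_last_exp[of \<alpha>] by blast
    then have "reach y (omega_power ?g) (omega_power (?e \<oplus> ?one))"
      using g reach_omega_power by blast
    moreover have "reach y (omega_power (?e \<oplus> ?one)) (omega_mult ?e y)"
      using succ_one[of ?e] g nf_fs[of ?g x] fs_omega_power_succ[of "?e \<oplus> ?one" y]
        reach_step[of y "omega_power (?e \<oplus> ?one)"] by auto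
    moreover have "reach y (omega_mult ?e y) (omega_power ?e \<oplus> ?one)"
      using add_one[of ?e 1 y] g nf_fs by auto
    ultimately show ?thesis using False reach_trans by (auto simp: fs_omega_power_limit)
  qed
  then have "reach y (init \<alpha> \<oplus> omega_power ?g) (init \<alpha> \<oplus> (fs (omega_power ?g) x \<oplus> ?one))"
    using less.prems last_exp_init_le[of \<alpha>]
    by (intro reach_hsum) (auto simp: nf_intros exps_omega_mult)
  then show ?case
    using less.prems init_hsum_last_exp[of \<alpha>] fs_eq_hsum[of \<alpha> x] by (auto simp: hsum_assoc nf_intros)
qed

lemma max_coef_hsum_omega_mult:
  "max_coef (\<alpha> \<oplus> omega_mult e k) \<le> max (max_coef e) (max_coef \<alpha> + k)"
  by (induction \<alpha>) (auto simp: omega_mult_def)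

text \<open>Write \<open>fs (omega_power b) x\<close> as \<open>omega_mult e k\<close>. If
  \<open>e\<close> is below the leading exponent of \<open>G\<close>, the coefficients of the target
  are small enough for \<open>reach_of_cless\<close>. Otherwise \<open>b\<close> descends to the
  successor of \<open>e\<close>, whose power splits into \<open>y\<close> copies of
  \<open>omega_power e\<close>: enough for the copies in the target and, if \<open>G\<close> has a
  nonzero rest, one more that descends to it.\<close>

lemma reach_omega_power_hsum_fs:
  assumes "nf b" "b \<noteq> Zero" "nf G" "lead_less G b" "1 \<le> x" "x + weight G \<le> y"
  shows "reach y (omega_power b) (G \<oplus> fs (omega_power b) x)"
proof (cases G)
  case Zero
  then show ?thesis using assms reach_fs[of "omega_power b" x y] by (simp add: nf_intros)
next
  case (Term g n r)
  have n: "1 \<le> n" and nfr: "nf g" "nf r" "lead_less r g" and gb: "g \<prec> b"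
    using assms Term by auto
  have G: "weight G = n * (weight g + 1) + weight r" using Term by simp
  have "n \<le> n * (weight g + 1)" by simp
  moreover have "weight g + 1 \<le> n * (weight g + 1)"
    using n mult_le_mono1[of 1 n "weight g + 1"] by simp
  ultimately have wG: "n + weight r \<le> weight G" "weight g + 1 + weight r \<le> weight G"
    unfolding G by linarith+
  have xy: "x < y" using assms(6) wG(2) by linarith
  let ?one = "omega_power Zero"
  \<comment> \<open>For a successor \<open>b\<close> the witnesses are \<open>init b\<close> and
    \<open>x\<close>, and \<open>init b\<close> cannot lie below \<open>g\<close>; for a limit they
    are \<open>fs b x\<close> and 1, where \<open>x < y\<close> supplies the extra
    \<open>?one\<close>.\<close>
  have "\<exists>e k. nf e \<and> fs (omega_power b) x = omega_mult e k \<and> k \<le> x \<and> reach y b (e \<oplus> ?one) \<and>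
    (e \<prec> g \<longrightarrow> e = fs b x \<and> k = 1)"
  proof (cases "last_exp b = Zero")
    case True
    have "b = init b \<oplus> ?one" using init_hsum_last_exp[of b] assms True by simp
    moreover have "\<not> init b \<prec> g"
      using cless_succ[of b g] assms True nfr gb cless_asym[of "init b" g] by auto
    ultimately show ?thesis using assms(1,2) True fs_omega_power_succ[of b x] reach_refl[of y b]
      by (intro exI[of _ "init b"] exI[of _ x]) (auto simp: nf_init)
  next
    case False
    then show ?thesis using assms fs_omega_power_limit[of b x] reach_fs_succ[of b x y] xy
      by (intro exI[of _ "fs b x"] exI[of _ 1]) (auto simp: nf_fs)
  qed
  then obtain e k where e: "nf e" "fs (omega_power b) x = omega_mult e k" "k \<le> x"
    "reach y b (e \<oplus> ?one)" "e \<prec> g \<Longrightarrow> e = fs b x \<and> k = 1" by blast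
  show ?thesis
  proof (cases "e \<prec> g")
    case True
    have k: "e = fs b x" "k = 1" using e(5) True by auto
    \<comment> \<open>Here \<open>g\<close> lies strictly between \<open>e = fs b x\<close> and
      \<open>b\<close>.\<close>
    have "max_coef e \<le> max x (max_coef g)"
      using max_coef_fs_between[of b g x] assms(1) nfr(1) True gb k by simp
    moreover have "max_coef g \<le> weight g" "max_coef r \<le> weight r"
      using max_coef_le_weight nfr by auto
    moreover have "max_coef (r \<oplus> omega_mult e k) \<le> max (max_coef e) (max_coef r + 1)"
      using max_coef_hsum_omega_mult[of r e k] k by simp
    moreover have sum: "G \<oplus> omega_mult e k = Term g n (r \<oplus> omega_mult e k)"
      using Term True k by (auto simp: omega_mult_def)
    ultimately have "max_coef (G \<oplus> omega_mult e k) < y"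
      using wG assms(5,6) unfolding sum by simp
    moreover have "G \<oplus> omega_mult e k \<prec> omega_power b" using sum gb by simp
    ultimately show ?thesis using assms e by (intro reach_of_cless) (auto simp: nf_intros)
  next
    case False
    \<comment> \<open>\<open>omega_mult e j\<close> is the leading term of \<open>G\<close> if its
      exponent is \<open>e\<close>; otherwise \<open>j\<close> is 0.\<close>
    obtain j G' where j: "G = omega_mult e j \<oplus> G'" "nf G'" "lead_less G' e" "j + weight G' \<le> weight G"
    proof (cases "e = g")
      case True
      then show ?thesis using that[of n r] Term_eq_hsum[of g n r] assms Term nfr wG by auto
    next
      case F: False
      then have "lead_less G e" using False cless_total[of e g] Term by auto
      then show ?thesis using that[of 0 G] assms by simp
    qed
    have "reach y (omega_power b) (omega_power (e \<oplus> ?one))"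
      using e assms xy by (intro reach_omega_power) auto
    moreover have "reach y (omega_power (e \<oplus> ?one)) (omega_mult e y)"
      using succ_one[of e] e(1) fs_omega_power_succ[of "e \<oplus> ?one" y]
        reach_step[of y "omega_power (e \<oplus> ?one)"] by auto
    moreover have "reach y (omega_mult e y) (omega_mult e (j + k) \<oplus> G')"
    proof (cases "G' = Zero")
      case True
      then show ?thesis using reach_omega_mult[of e "j + k" y y] e j assms by simp
    next
      case G': False
      then have "1 \<le> max_coef G'" using j(2) by (cases G') auto
      \<comment> \<open>The positive weight of the rest pays for the additional copy in
        \<open>j + k + 1 \<le> y\<close>.\<close>
      then have "1 \<le> weight G'" using max_coef_le_weight[OF j(2)] by simp
      have "max_coef G' < y" using max_coef_le_weight[OF j(2)] j(4) assms(5,6) by simp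
      moreover have "G' \<prec> omega_power e" using j(3) by (cases G') auto
      ultimately have "reach y (omega_power e) G'" using e j by (intro reach_of_cless) (auto simp: nf_intros)
      then have "reach y (omega_mult e (j + k) \<oplus> omega_power e) (omega_mult e (j + k) \<oplus> G')"
        using e by (intro reach_hsum) (auto simp: nf_intros exps_omega_mult)
      moreover have "j + k + 1 \<le> y" using j(4) e(3) assms(6) \<open>1 \<le> weight G'\<close> by simp
      ultimately show ?thesis
        using reach_omega_mult[of e "j + k + 1" y y] omega_mult_add[of e "j + k" 1] e(1) reach_trans by auto
    qed
    moreover have "omega_mult e (j + k) \<oplus> G' = G \<oplus> fs (omega_power b) x"
      using e j by (intro cnf_eqI) (auto simp: nf_intros)
    ultimately show ?thesis using reach_trans by metis
  qed
qed

subsection \<open>Runs along increasing lists\<close>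

lemma foldl_fs_Zero [simp]: "foldl fs Zero xs = Zero"
  by (induction xs) auto

text \<open>At the first element \<open>x\<close> either both ordinals agree or
  \<open>fs \<alpha> x\<close> still reaches \<open>\<delta>\<close> and hence
  \<open>fs \<delta> x\<close>; the relation survives at \<open>x\<close>, below the remaining
  elements.\<close>

lemma foldl_fs_reach:
  assumes "reach y \<alpha> \<delta>" "nf \<alpha>" "sorted_wrt (<) xs" "\<forall>x\<in>set xs. y \<le> x" "foldl fs \<alpha> xs = Zero"
  shows "foldl fs \<delta> xs = Zero"
  using assms
proof (induction xs arbitrary: y \<alpha> \<delta>)
  case Nil
  then show ?case using reach_Zero_iff by simp
next
  case (Cons x xs)
  have \<delta>: "nf \<delta>" using Cons.prems nf_reach by blast
  have x: "reach x \<alpha> \<delta>" using Cons.prems reach_mono by auto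
  show ?case
  proof (cases "\<delta> = \<alpha>")
    case False
    then have "reach x (fs \<alpha> x) \<delta>" using x reach_cases by blast
    then have "reach x (fs \<alpha> x) (fs \<delta> x)" using reach_trans reach_step by blast
    moreover have "\<forall>z\<in>set xs. x \<le> z" using Cons.prems(3) by auto
    ultimately show ?thesis using Cons.IH[of x "fs \<alpha> x" "fs \<delta> x"] Cons.prems by (simp add: nf_fs)
  qed (use Cons.prems in simp)
qed

lemma foldl_fs_append:
  assumes "nf \<alpha>" "sorted_wrt (<) (us @ vs)" "foldl fs \<alpha> vs = Zero"
  shows "foldl fs \<alpha> (us @ vs) = Zero"
  using assms(2)
proof (induction us)
  case (Cons u us)
  then have "\<forall>x\<in>set (us @ vs). u \<le> x" "sorted_wrt (<) (us @ vs)" by (auto intro: less_imp_le)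
  moreover have "foldl fs \<alpha> (us @ vs) = Zero" using Cons by simp
  ultimately have "foldl fs (fs \<alpha> u) (us @ vs) = Zero"
    using foldl_fs_reach[OF reach_step assms(1)] by blast
  then show ?case by simp
qed (use assms in simp)

text \<open>The elements first work on \<open>L\<close>, whose exponents do not exceed those of
  \<open>K\<close>, and each lowers its weight by at most one; \<open>us\<close> is the part of the
  list spent on \<open>L\<close>.\<close>

lemma foldl_fs_hsum_split:
  assumes "nf K" "nf L" "\<forall>k\<in>exps K. \<forall>l\<in>exps L. \<not> k \<prec> l" "\<forall>x\<in>set xs. 1 \<le> x"
    "foldl fs (K \<oplus> L) xs = Zero"
  shows "\<exists>us vs. xs = us @ vs \<and> weight L \<le> length us \<and> foldl fs K vs = Zero"
  using assms(2-)
proof (induction xs arbitrary: L)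
  case Nil
  then show ?case by simp
next
  case (Cons x xs)
  show ?case
  proof (cases "L = Zero")
    case True
    then have "x # xs = [] @ x # xs \<and> weight L \<le> length ([] :: nat list) \<and> foldl fs K (x # xs) = Zero"
      using Cons.prems by simp
    then show ?thesis by blast
  next
    case False
    have "fs (K \<oplus> L) x = K \<oplus> fs L x"
      using Cons.prems assms(1) False last_exp_in_exps by (intro fs_hsum) auto
    moreover have "\<forall>k\<in>exps K. \<forall>l\<in>exps (fs L x). \<not> k \<prec> l"
      using Cons.prems(1,2) exps_fs[of L _ x] cless_trans by blast
    ultimately obtain us vs where "xs = us @ vs" "weight (fs L x) \<le> length us" "foldl fs K vs = Zero"
      using Cons.IH[of "fs L x"] Cons.prems by (auto simp: nf_fs)
    moreover have "weight L \<le> weight (fs L x) + 1" using weight_le_fs Cons.prems by simp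
    ultimately have "x # xs = (x # us) @ vs \<and> weight L \<le> length (x # us) \<and> foldl fs K vs = Zero"
      by simp
    then show ?thesis by blast
  qed
qed

lemma sorted_wrt_less_append_bound:
  fixes x :: nat
  shows "sorted_wrt (<) (x # us @ vs) \<Longrightarrow> v \<in> set vs \<Longrightarrow> x + length us < v"
proof (induction us arbitrary: x)
  case (Cons u us)
  then have "x < u" "u + length us < v" by auto
  then show ?case by simp
qed auto

text \<open>The common pattern of the exchanges: on the elements left after \<open>L\<close> is used
  up, \<open>H \<oplus> E\<close> vanishes because \<open>H \<oplus> omega_power b\<close> reaches
  it; the elements spent on \<open>L\<close> are put back in front by
  \<open>foldl_fs_append\<close>.\<close>

lemma foldl_fs_replace:
  assumes "nf H" "nf b" "nf L" "\<forall>h\<in>exps H. \<not> h \<prec> b" "lead_less L b"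
    and "reach (x + weight L + 1) (omega_power b) E" "sorted_wrt (<) (x # xs)"
    and "foldl fs (H \<oplus> omega_power b \<oplus> L) xs = Zero"
  shows "foldl fs (H \<oplus> E) xs = Zero"
proof -
  have "\<forall>e\<in>exps L. e \<prec> b" using assms(3,5) lead_less_iff by blast
  moreover have "\<forall>k\<in>exps (H \<oplus> omega_power b). \<not> k \<prec> b"
    using assms(4) by (auto simp: exps_omega_mult)
  ultimately have "\<forall>k\<in>exps (H \<oplus> omega_power b). \<forall>l\<in>exps L. \<not> k \<prec> l"
    using cless_trans by blast
  moreover have "\<forall>z\<in>set xs. 1 \<le> z" using assms(7) by fastforce
  ultimately obtain us vs where us: "xs = us @ vs" "weight L \<le> length us"
    "foldl fs (H \<oplus> omega_power b) vs = Zero"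
    using foldl_fs_hsum_split[of "H \<oplus> omega_power b" L xs] assms(1-3,8) by (auto simp: nf_intros)
  have bound: "\<forall>v\<in>set vs. x + weight L + 1 \<le> v"
    using sorted_wrt_less_append_bound[of x us vs] assms(7) us(1,2) by fastforce
  have E: "nf E" using nf_reach[OF assms(6)] assms(2) by (simp add: nf_intros)
  have "reach (x + weight L + 1) (H \<oplus> omega_power b) (H \<oplus> E)"
    using assms by (intro reach_hsum) (auto simp: nf_intros exps_omega_mult)
  then have "foldl fs (H \<oplus> E) vs = Zero"
    using foldl_fs_reach bound us(1,3) assms(1,2,7) by (simp add: nf_intros sorted_wrt_append)
  then show ?thesis using foldl_fs_append assms(1,7) E us(1) by (simp add: nf_intros)
qed

section \<open>Exchanging the power that is reduced\<close>

lemma cnf_split: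
  assumes "nf D"
  obtains H M where "nf H" "nf M" "D = H \<oplus> M" "\<forall>h\<in>exps H. \<not> h \<prec> b" "lead_less M b"
  using assms
proof (induction D arbitrary: thesis)
  case Zero
  then show ?case using Zero.prems(1)[of Zero Zero] by simp
next
  case (Term a n c)
  show ?case
  proof (cases "a \<prec> b")
    case True
    then show ?thesis using Term.prems(1)[of Zero "Term a n c"] Term.prems(2) by simp
  next
    case False
    obtain H M where HM: "nf H" "nf M" "c = H \<oplus> M" "\<forall>h\<in>exps H. \<not> h \<prec> b" "lead_less M b"
      using Term.IH(2) Term.prems(2) by auto
    have "Term a n c = omega_mult a n \<oplus> H \<oplus> M"
      using HM Term.prems(2) nf_omega_mult[of a n]
      by (intro cnf_eqI) (auto simp: nf_hsum)
    moreover have "nf (omega_mult a n \<oplus> H)" using HM Term.prems(2) by (simp add: nf_intros)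
    moreover have "\<forall>h\<in>exps (omega_mult a n \<oplus> H). \<not> h \<prec> b"
      using HM False by (auto simp: exps_omega_mult)
    ultimately show ?thesis using Term.prems(1) HM by blast
  qed
qed

text \<open>\<open>foldl_fs_replace\<close> with \<open>M\<close> as both \<open>L\<close> and
  \<open>E\<close>: \<open>M\<close> lies below \<open>omega_power b\<close> and its coefficients
  are bounded by its weight, so the power reaches it.\<close>

lemma foldl_fs_hsum_omega_power_drop:
  assumes "nf D" "nf b" "sorted_wrt (<) (x # xs)" "foldl fs (D \<oplus> omega_power b) xs = Zero"
  shows "foldl fs D xs = Zero"
proof -
  obtain H M where HM: "nf H" "nf M" "D = H \<oplus> M" "\<forall>h\<in>exps H. \<not> h \<prec> b" "lead_less M b"
    using cnf_split[OF assms(1)] by blast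
  have eq: "D \<oplus> omega_power b = H \<oplus> omega_power b \<oplus> M"
    using HM assms(2) by (intro cnf_eqI) (auto simp: nf_intros)
  have "M \<prec> omega_power b" using HM(5) by (cases M) auto
  then have "reach (x + weight M + 1) (omega_power b) M"
    using max_coef_le_weight[OF HM(2)] HM assms(2) by (intro reach_of_cless) (auto simp: nf_intros)
  then show ?thesis
    using foldl_fs_replace[OF HM(1) assms(2) HM(2,4,5) _ assms(3)] assms(4) HM(3) eq by simp
qed

lemma foldl_fs_hsum_omega_power_fs:
  assumes "nf D" "nf b" "1 \<le> x" "sorted_wrt (<) (x # xs)"
    and "foldl fs (D \<oplus> omega_power b) xs = Zero"
  shows "foldl fs (D \<oplus> fs (omega_power b) x) xs = Zero"
proof (cases "b = Zero")
  case True
  then show ?thesis using foldl_fs_hsum_omega_power_drop[OF assms(1,2,4,5)] by simp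
next
  case False
  obtain H M where HM: "nf H" "nf M" "D = H \<oplus> M" "\<forall>h\<in>exps H. \<not> h \<prec> b" "lead_less M b"
    using cnf_split[OF assms(1)] by blast
  have eq: "D \<oplus> omega_power b = H \<oplus> omega_power b \<oplus> M"
    using HM assms(2) by (intro cnf_eqI) (auto simp: nf_intros)
  have "reach (x + weight M + 1) (omega_power b) (M \<oplus> fs (omega_power b) x)"
    using HM assms False by (intro reach_omega_power_hsum_fs) auto
  then have "foldl fs (H \<oplus> (M \<oplus> fs (omega_power b) x)) xs = Zero"
    using foldl_fs_replace[OF HM(1) assms(2) HM(2,4,5) _ assms(4)] assms(5) eq by simp
  then show ?thesis using HM assms by (simp add: hsum_assoc nf_intros)
qed

text \<open>Singles out the last power of \<open>\<beta>\<close> and treats all the rest as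
  \<open>?D\<close>. It serves elements of both sets, where both summands are reduced at the same
  argument.\<close>

lemma foldl_fs_hsum_fs:
  assumes "nf \<beta>" "nf \<gamma>" "1 \<le> x" "sorted_wrt (<) (x # xs)" "foldl fs (\<beta> \<oplus> \<gamma>) xs = Zero"
  shows "foldl fs (fs \<beta> x \<oplus> \<gamma>) xs = Zero"
proof (cases "\<beta> = Zero")
  case False
  let ?b = "last_exp \<beta>" and ?D = "init \<beta> \<oplus> \<gamma>"
  have "\<beta> \<oplus> \<gamma> = init \<beta> \<oplus> omega_power ?b \<oplus> \<gamma>" using init_hsum_last_exp[of \<beta>] assms False by simp
  also have "\<dots> = ?D \<oplus> omega_power ?b"
    using assms by (intro cnf_eqI) (auto simp: nf_intros)
  finally have "foldl fs (?D \<oplus> fs (omega_power ?b) x) xs = Zero"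
    using foldl_fs_hsum_omega_power_fs[of ?D ?b x xs] assms by (simp add: nf_intros)
  moreover have "?D \<oplus> fs (omega_power ?b) x = init \<beta> \<oplus> fs (omega_power ?b) x \<oplus> \<gamma>"
    using assms by (intro cnf_eqI) (auto simp: nf_intros)
  ultimately show ?thesis using fs_eq_hsum[of \<beta> x] assms False by simp
qed (use assms in simp)

text \<open>Removes the powers of \<open>\<beta>\<close> one at a time, the last one first. It
  serves the stage where one of the two sets has no elements left.\<close>

lemma foldl_fs_hsum_drop:
  assumes "nf \<beta>" "nf \<gamma>" "sorted_wrt (<) (x # xs)" "foldl fs (\<beta> \<oplus> \<gamma>) xs = Zero"
  shows "foldl fs \<gamma> xs = Zero"
  using assms(1,4)
proof (induction \<beta> rule: nf_wf_induct)
  case (less \<beta>)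
  show ?case
  proof (cases "\<beta> = Zero")
    case False
    let ?b = "last_exp \<beta>" and ?D = "init \<beta> \<oplus> \<gamma>"
    have "\<beta> \<oplus> \<gamma> = init \<beta> \<oplus> omega_power ?b \<oplus> \<gamma>" using init_hsum_last_exp[of \<beta>] less False by simp
    also have "\<dots> = ?D \<oplus> omega_power ?b"
      using assms(2) less by (intro cnf_eqI) (auto simp: nf_intros)
    finally have "foldl fs ?D xs = Zero"
      using foldl_fs_hsum_omega_power_drop[of ?D ?b x xs] assms less by (simp add: nf_intros)
    then show ?thesis
      using less.IH[of "init \<beta>"] less.hyps False init_cless by (auto simp: nf_intros)
  qed (use less in simp)
qed

text \<open>On the side that reduces \<open>\<gamma>\<close>, the part \<open>?L\<close> is used up
  before \<open>omega_power ?b\<close> is touched; by then this power reaches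
  \<open>?G \<oplus> ?pb\<close>, its counterpart on the other side together with everything
  below.\<close>

lemma foldl_fs_exchange:
  assumes "nf \<beta>" "nf \<gamma>" "\<beta> \<noteq> Zero" "\<gamma> \<noteq> Zero" "last_exp \<gamma> \<prec> last_exp \<beta>"
    and "1 \<le> x" "sorted_wrt (<) (x # xs)" "foldl fs (\<beta> \<oplus> fs \<gamma> x) xs = Zero"
  shows "foldl fs (fs \<beta> x \<oplus> \<gamma>) xs = Zero"
proof -
  let ?b = "last_exp \<beta>" and ?c = "last_exp \<gamma>"
  let ?pb = "fs (omega_power ?b) x" and ?pc = "fs (omega_power ?c) x"
  obtain H M where HM: "nf H" "nf M" "init \<beta> \<oplus> init \<gamma> = H \<oplus> M" "\<forall>h\<in>exps H. \<not> h \<prec> ?b" "lead_less M ?b"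
    using cnf_split[of "init \<beta> \<oplus> init \<gamma>"] assms(1,2) by (auto simp: nf_intros)
  have co: "coef (init \<beta>) e + coef (init \<gamma>) e = coef H e + coef M e" for e
    using HM(3) coef_hsum by metis
  note nfs = nf_intros assms(1,2) HM(1,2)
  let ?L = "M \<oplus> ?pc" and ?G = "M \<oplus> omega_power ?c"
  have "\<beta> = init \<beta> \<oplus> omega_power ?b" "\<gamma> = init \<gamma> \<oplus> omega_power ?c"
    "fs \<beta> x = init \<beta> \<oplus> ?pb" "fs \<gamma> x = init \<gamma> \<oplus> ?pc"
    using init_hsum_last_exp fs_eq_hsum assms by auto
  then have l: "\<beta> \<oplus> fs \<gamma> x = (init \<beta> \<oplus> omega_power ?b) \<oplus> (init \<gamma> \<oplus> ?pc)"
    and r: "fs \<beta> x \<oplus> \<gamma> = (init \<beta> \<oplus> ?pb) \<oplus> (init \<gamma> \<oplus> omega_power ?c)" by metis+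
  have l': "\<beta> \<oplus> fs \<gamma> x = H \<oplus> omega_power ?b \<oplus> ?L"
    unfolding l using co by (intro cnf_eqI) (auto simp: nfs algebra_simps)
  have r': "fs \<beta> x \<oplus> \<gamma> = H \<oplus> (?G \<oplus> ?pb)"
    unfolding r using co by (intro cnf_eqI) (auto simp: nfs algebra_simps)
  have c: "\<forall>e\<in>exps ?pc. e \<prec> ?b"
    using exps_fs_omega_power[of ?c _ x] assms(2,5) cless_trans by (blast intro: nf_last_exp)
  have L: "lead_less ?L ?b" and G: "lead_less ?G ?b"
    using HM(5) c assms(5) by (auto simp: lead_less_iff nfs exps_omega_mult)
  have "?b \<noteq> Zero" using assms(5) by auto
  \<comment> \<open>Replacing \<open>omega_power ?c\<close> by \<open>?pc\<close> loses at most one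
    symbol, which the 1 in \<open>x + weight ?L + 1\<close> makes up for.\<close>
  moreover have "weight (omega_power ?c) \<le> weight ?pc + 1"
    using weight_omega_power_le_fs assms(2,6) by (simp add: nf_last_exp)
  then have "x + weight ?G \<le> x + weight ?L + 1" unfolding weight_hsum by linarith
  ultimately have "reach (x + weight ?L + 1) (omega_power ?b) (?G \<oplus> ?pb)"
    using G assms(6) by (intro reach_omega_power_hsum_fs) (auto simp: nfs)
  then show ?thesis
    unfolding r' using foldl_fs_replace[OF HM(1) _ _ HM(4) L _ assms(7)] assms(8) l'
    by (simp add: nfs)
qed

text \<open>If \<open>\<gamma>\<close> has the smaller last exponent, \<open>fs\<close> reduces
  \<open>\<gamma>\<close> and \<open>foldl_fs_exchange\<close> moves the step to
  \<open>\<beta>\<close>; otherwise, equality included, the step can be taken in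
  \<open>\<beta>\<close> at once.\<close>

lemma foldl_fs_hsum_Cons:
  assumes "nf \<beta>" "nf \<gamma>" "\<beta> \<noteq> Zero" "\<gamma> \<noteq> Zero" "1 \<le> x" "sorted_wrt (<) (x # xs)"
    and "foldl fs (\<beta> \<oplus> \<gamma>) (x # xs) = Zero"
  shows "foldl fs (fs \<beta> x \<oplus> \<gamma>) xs = Zero"
proof -
  have C: "\<beta> \<oplus> \<gamma> = \<gamma> \<oplus> \<beta>" "\<gamma> \<oplus> fs \<beta> x = fs \<beta> x \<oplus> \<gamma>"
    using assms by (auto intro!: hsum_commute simp: nf_fs)
  show ?thesis
  proof (cases "last_exp \<gamma> \<prec> last_exp \<beta>")
    case True
    then have "fs (\<beta> \<oplus> \<gamma>) x = \<beta> \<oplus> fs \<gamma> x"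
      using assms last_exp_le[of \<beta>] cless_trans by (intro fs_hsum) blast+
    then show ?thesis using foldl_fs_exchange True assms by auto
  next
    case False
    then have "fs (\<gamma> \<oplus> \<beta>) x = \<gamma> \<oplus> fs \<beta> x"
      using assms last_exp_le[of \<gamma>] cless_trans cless_total by (intro fs_hsum) blast+
    then show ?thesis using assms C by simp
  qed
qed

section \<open>Runs along a union\<close>

text \<open>Induction along the list: an element of \<open>B\<close> reduces \<open>\<beta>\<close>,
  one of \<open>C\<close> reduces \<open>\<gamma>\<close>, and a run that exhausts the sum would
  also exhaust the sum of the reduced ordinals. The hypotheses are conditional because an exhausted
  set imposes nothing more on its ordinal.\<close>

lemma foldl_fs_butlast_union:
  assumes "nf \<beta>" "nf \<gamma>" "sorted_wrt (<) xs" "\<forall>x\<in>set xs. 1 \<le> x" "xs \<noteq> []" "set xs \<subseteq> B \<union> C"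
    and "filter (\<lambda>x. x \<in> B) xs \<noteq> [] \<Longrightarrow> foldl fs \<beta> (butlast (filter (\<lambda>x. x \<in> B) xs)) \<noteq> Zero"
    and "filter (\<lambda>x. x \<in> C) xs \<noteq> [] \<Longrightarrow> foldl fs \<gamma> (butlast (filter (\<lambda>x. x \<in> C) xs)) \<noteq> Zero"
  shows "foldl fs (\<beta> \<oplus> \<gamma>) (butlast xs) \<noteq> Zero"
  using assms
proof (induction xs arbitrary: \<beta> \<gamma>)
  case (Cons x xs)
  note nfs = Cons.prems(1,2)
  let ?B = "\<lambda>xs. filter (\<lambda>x. x \<in> B) xs" and ?C = "\<lambda>xs. filter (\<lambda>x. x \<in> C) xs"
  have comm: "\<beta> \<oplus> \<gamma> = \<gamma> \<oplus> \<beta>" using nfs by (rule hsum_commute)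
  have ne: "?B (x # xs) \<noteq> [] \<Longrightarrow> \<beta> \<noteq> Zero" "?C (x # xs) \<noteq> [] \<Longrightarrow> \<gamma> \<noteq> Zero"
    using Cons.prems(7,8) foldl_fs_Zero by blast+
  \<comment> \<open>The 0 in front is the lower bound that \<open>foldl_fs_hsum_drop\<close> asks
    for; all elements are positive.\<close>
  have sorted: "sorted_wrt (<) (0 # butlast (x # xs))"
    using Cons.prems(3,4) sorted_wrt_take[of "(<)" "x # xs"] in_set_butlastD[of _ "x # xs"]
    by (fastforce simp: butlast_conv_take)
  show ?case
  proof (cases "?B (x # xs) = [] \<or> ?C (x # xs) = [] \<or> xs = []")
    case True
    then consider "?B (x # xs) = []" | "?C (x # xs) = []" | "xs = []" by blast
    then show ?thesis
    proof cases
      case 1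
      \<comment> \<open>All remaining elements lie in \<open>C\<close>, so dropping
        \<open>\<beta>\<close> leaves the hypothesis on \<open>\<gamma>\<close>.\<close>
      then have "?C (x # xs) = x # xs"
        using Cons.prems(6) by (intro filter_True) (auto simp del: filter.simps simp: filter_empty_conv)
      then show ?thesis using Cons.prems(8) foldl_fs_hsum_drop[OF nfs sorted] by auto
    next
      case 2
      then have "?B (x # xs) = x # xs"
        using Cons.prems(6) by (intro filter_True) (auto simp del: filter.simps simp: filter_empty_conv)
      then show ?thesis
        using Cons.prems(7) foldl_fs_hsum_drop[OF nfs(2,1) sorted] comm by auto
    next
      case 3
      then show ?thesis using ne Cons.prems(6) by auto
    qed
  next
    case False
    let ?ys = "butlast xs"
    have b: "butlast (x # xs) = x # ?ys" using False by simp
    have s: "sorted_wrt (<) (x # ?ys)" "1 \<le> x" using sorted b Cons.prems(4) by auto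
    show ?thesis
    proof
      assume "foldl fs (\<beta> \<oplus> \<gamma>) (butlast (x # xs)) = Zero"
      then have z: "foldl fs (\<beta> \<oplus> \<gamma>) (x # ?ys) = Zero" "foldl fs (\<gamma> \<oplus> \<beta>) (x # ?ys) = Zero"
        using b comm by simp_all
      have zb: "foldl fs (fs \<beta> x \<oplus> \<gamma>) ?ys = Zero"
        using foldl_fs_hsum_Cons[OF nfs _ _ s(2,1) z(1)] ne False by auto
      have zc: "foldl fs (fs \<gamma> x \<oplus> \<beta>) ?ys = Zero"
        using foldl_fs_hsum_Cons[OF nfs(2,1) _ _ s(2,1) z(2)] ne False by auto
      then have zc: "foldl fs (\<beta> \<oplus> fs \<gamma> x) ?ys = Zero" using hsum_commute nfs nf_fs by metis
      \<comment> \<open>For \<open>x\<close> in both sets, \<open>\<beta>\<close> is reduced in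
        addition to \<open>\<gamma>\<close>.\<close>
      have zbc: "foldl fs (fs \<beta> x \<oplus> fs \<gamma> x) ?ys = Zero"
        using foldl_fs_hsum_fs[OF nfs(1) nf_fs[OF nfs(2)] s(2,1) zc] .
      let ?\<beta> = "if x \<in> B then fs \<beta> x else \<beta>" and ?\<gamma> = "if x \<in> C then fs \<gamma> x else \<gamma>"
      have "foldl fs (?\<beta> \<oplus> ?\<gamma>) ?ys \<noteq> Zero"
      proof (rule Cons.IH)
        show "?B xs \<noteq> [] \<Longrightarrow> foldl fs ?\<beta> (butlast (?B xs)) \<noteq> Zero"
          using Cons.prems(7) by (cases "x \<in> B") auto
        show "?C xs \<noteq> [] \<Longrightarrow> foldl fs ?\<gamma> (butlast (?C xs)) \<noteq> Zero"
          using Cons.prems(8) by (cases "x \<in> C") auto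
      qed (use Cons.prems False in \<open>auto simp: nf_fs\<close>)
      moreover have "x \<in> B \<or> x \<in> C" using Cons.prems(6) by auto
      ultimately show False using zb zc zbc by (auto split: if_splits)
    qed
  qed
qed simp

lemma sorted_list_of_set_Diff_Max:
  assumes "finite X" "X \<noteq> {}"
  shows "sorted_list_of_set (X - {Max X}) = butlast (sorted_list_of_set X)"
proof -
  have "X = insert (Max X) (X - {Max X})" using Max_in[OF assms] by blast
  moreover have "finite (X - {Max X})" "\<forall>y\<in>X - {Max X}. y < Max X"
    using assms by (auto simp: less_le)
  ultimately have "sorted_list_of_set X = sorted_list_of_set (X - {Max X}) @ [Max X]"
    by (intro sorted_distinct_set_unique) (auto simp: sorted_append less_imp_le)
  then show ?thesis by simp
qed

lemma at_most_large_iff: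
  assumes "finite X" "X \<noteq> {}"
  shows "at_most_large \<alpha> X \<longleftrightarrow> foldl fs \<alpha> (butlast (sorted_list_of_set X)) \<noteq> Zero"
  using assms sorted_list_of_set_Diff_Max[OF assms]
  by (simp add: at_most_large_def small_def large_def fs_set_def)

theorem theorem1:
  fixes \<beta> \<gamma> :: cnf and B C :: "nat set"
  assumes "nf \<beta>" and "nf \<gamma>"
    and "B \<subseteq> {1..}" and "C \<subseteq> {1..}"
    and "finite B" and "finite C"
    and "at_most_large \<beta> B" and "at_most_large \<gamma> C"
  shows "at_most_large (\<beta> \<oplus> \<gamma>) (B \<union> C)"
proof (cases "B \<union> C = {}")
  case True
  then show ?thesis using assms by (auto simp: at_most_large_def)
next
  case False
  let ?xs = "sorted_list_of_set (B \<union> C)"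
  have fin: "finite (B \<union> C)" using assms by simp
  \<comment> \<open>Sorted distinct lists with the same elements coincide, so filtering the
    enumeration of the union yields those of \<open>B\<close> and \<open>C\<close>.\<close>
  have "filter (\<lambda>x. x \<in> S) ?xs = sorted_list_of_set S" if "S \<subseteq> B \<union> C" for S
    using that fin finite_subset[OF that fin]
    by (intro sorted_distinct_set_unique) (auto intro: sorted_filter[where f = id, simplified])
  then have filter: "filter (\<lambda>x. x \<in> B) ?xs = sorted_list_of_set B"
    "filter (\<lambda>x. x \<in> C) ?xs = sorted_list_of_set C" by auto
  have "foldl fs (\<beta> \<oplus> \<gamma>) (butlast ?xs) \<noteq> Zero"
  proof (rule foldl_fs_butlast_union[where B = B and C = C])
    show "filter (\<lambda>x. x \<in> B) ?xs \<noteq> [] \<Longrightarrow> foldl fs \<beta> (butlast (filter (\<lambda>x. x \<in> B) ?xs)) \<noteq> Zero"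
      using assms(5,7) at_most_large_iff unfolding filter by auto
    show "filter (\<lambda>x. x \<in> C) ?xs \<noteq> [] \<Longrightarrow> foldl fs \<gamma> (butlast (filter (\<lambda>x. x \<in> C) ?xs)) \<noteq> Zero"
      using assms(6,8) at_most_large_iff unfolding filter by auto
  qed (use assms fin False in \<open>auto\<close>)
  then show ?thesis using at_most_large_iff[OF fin False] by simp
qed

end
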